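(* For every $n\ge3$, the number $N_n$ of double-MDS-codes in $\{0,1,2,3\}^n$ satisfies $N_n\le 2^{\alpha^n}$ for a constant $\alpha<2.955$ (one can take $\alpha=225^{1/5}$). Moreover, $N_n<2^{2.925^n}$ for all sufficiently large $n$.
   Context: Let $\Sigma=\{0,1,2,3\}$. A line in $\Sigma^n$ is a set of $4$ words agreeing in all coordinates but one. A set $S\subseteq\Sigma^n$ is a double-MDS-code if every line contains exactly two elements of $S$; equivalently, its characteristic function is a frequency hypercube $\mathrm{F}^n(4;2,2)$. *)

theory Defs
  imports Complex_Main
begin

definition alphabet :: "nat set" where
  "alphabet = {0, 1, 2, 3}"

definition words :: "nat \<Rightarrow> nat list set" where
  "words n = {w. length w = n \<and> set w \<subseteq> alphabet}"

definition is_line :: "nat \<Rightarrow> nat list set \<Rightarrow> bool" where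
  "is_line n L \<longleftrightarrow> L \<subseteq> words n \<and> card L = 4 \<and>
     (\<exists>i<n. \<forall>u\<in>L. \<forall>v\<in>L. \<forall>j<n. j \<noteq> i \<longrightarrow> u ! j = v ! j)"

definition double_MDS_code :: "nat \<Rightarrow> nat list set \<Rightarrow> bool" where
  "double_MDS_code n S \<longleftrightarrow> S \<subseteq> words n \<and> (\<forall>L. is_line n L \<longrightarrow> card (L \<inter> S) = 2)"

definition num_double_MDS_codes :: "nat \<Rightarrow> nat" where
  "num_double_MDS_codes n = card {S. double_MDS_code n S}"

lemma finite_words: "finite (words n)"
proof -
  have "finite {w. set w \<subseteq> alphabet \<and> length w = n}"
    by (rule finite_lists_length_eq) (simp add: alphabet_def)
  then show ?thesis
    by (simp add: words_def conj_commute)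
qed

lemma finite_double_MDS_codes: "finite {S. double_MDS_code n S}"
  by (rule finite_subset[of _ "Pow (words n)"]) (auto simp: double_MDS_code_def finite_words)

end

theory Submission
  imports Defs
begin

text \<open>
  A testing set is a set of words on which no two distinct codes agree, so a testing set of size
  \<open>t\<close> bounds the number of codes by \<open>2 ^ t\<close>.  Testing sets multiply under concatenation, because
  every section of a code is a code.  Three letters form a testing set for \<open>n = 1\<close>.

  For \<open>n = 3\<close> there is a testing set of size 25.  The difference \<open>g\<close> of two codes has values in
  \<open>{-1, 0, 1}\<close> and all its line sums vanish; such functions span a 27-dimensional space.  The 25
  words were found by computer search so that the subspace vanishing on them has dimension 2, with coordinates
  \<open>a = g 0 3 2\<close> and \<open>b = g 0 2 0\<close>, and so that \<open>g 1 0 3 = -2 * a\<close> and \<open>g 3 0 2 = - a - 2 * b\<close>.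
  Since no value exceeds 1 in modulus, \<open>a = 0\<close>, then \<open>b = 0\<close>, and \<open>g = 0\<close>.

  Hence there is a testing set of size \<open>25 ^ (n div 3) * 3 ^ (n mod 3)\<close>; its growth rate is
  \<open>25 powr (1/3) < 2.925\<close>, and the worst case of its \<open>n\<close>-th root for \<open>n \<ge> 3\<close> is at \<open>n = 5\<close>.
\<close>

section \<open>Line sums and sections of codes\<close>

lemma append_in_words: "u \<in> words m \<Longrightarrow> v \<in> words n \<Longrightarrow> u @ v \<in> words (m + n)"
  by (auto simp: words_def)

text \<open>The words obtained by varying one letter form a line, so the counting condition becomes
  a linear equation. Integer values let the equations of two codes be subtracted.\<close>

lemma double_MDS_code_line_sum:
  assumes S: "double_MDS_code n S" and u: "set u \<subseteq> alphabet" and v: "set v \<subseteq> alphabet"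
    and n: "length u + Suc (length v) = n"
  shows "(\<Sum>x\<in>alphabet. of_bool (u @ x # v \<in> S)) = (2::int)"
proof -
  let ?p = "\<lambda>x. u @ x # v"
  have inj: "inj_on ?p A" for A
    by (auto simp: inj_on_def)
  have "is_line n (?p ` alphabet)"
    unfolding is_line_def
  proof (intro conjI exI[of _ "length u"])
    show "?p ` alphabet \<subseteq> words n"
      using u v n by (auto simp: words_def)
    show "card (?p ` alphabet) = 4"
      by (subst card_image[OF inj]) (simp add: alphabet_def)
    show "length u < n"
      using n by simp
    show "\<forall>x\<in>?p ` alphabet. \<forall>y\<in>?p ` alphabet. \<forall>j<n. j \<noteq> length u \<longrightarrow> x ! j = y ! j"
      by (auto simp: nth_append nth_Cons')
  qed
  then have "card (?p ` alphabet \<inter> S) = 2"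
    using S by (simp add: double_MDS_code_def)
  also have "?p ` alphabet \<inter> S = ?p ` {x\<in>alphabet. ?p x \<in> S}"
    by auto
  also have "card \<dots> = card {x\<in>alphabet. ?p x \<in> S}"
    by (rule card_image[OF inj])
  finally have "card {x\<in>alphabet. ?p x \<in> S} = 2" .
  moreover have "(\<Sum>x\<in>alphabet. of_bool (?p x \<in> S)) = int (card {x\<in>alphabet. ?p x \<in> S})"
    by (simp add: of_bool_def sum.If_cases alphabet_def Int_def)
  ultimately show ?thesis
    by simp
qed

lemma double_MDS_code_eqI:
  assumes "double_MDS_code n S" "double_MDS_code n S'"
    and "\<And>w. w \<in> words n \<Longrightarrow> w \<in> S \<longleftrightarrow> w \<in> S'"
  shows "S = S'"
  using assms unfolding double_MDS_code_def by blast

text \<open>Common source of both kinds of section: an injection taking lines to lines preserves the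
  size of each intersection of a line with the code, so codes pull back to codes.\<close>

lemma double_MDS_code_sectionI:
  assumes S: "double_MDS_code k S" and inj: "inj_on h (words n)"
    and lines: "\<And>L. is_line n L \<Longrightarrow> is_line k (h ` L)"
  shows "double_MDS_code n {w \<in> words n. h w \<in> S}"
  unfolding double_MDS_code_def
proof (intro conjI allI impI)
  fix L assume L: "is_line n L"
  then have sub: "L \<subseteq> words n"
    by (simp add: is_line_def)
  have "card (L \<inter> {w \<in> words n. h w \<in> S}) = card (h ` (L \<inter> {w \<in> words n. h w \<in> S}))"
    using sub by (intro card_image[symmetric] inj_on_subset[OF inj]) auto
  also have "h ` (L \<inter> {w \<in> words n. h w \<in> S}) = h ` L \<inter> S"
    using sub by auto
  also have "card \<dots> = 2"
    using S lines[OF L] by (simp add: double_MDS_code_def)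
  finally show "card (L \<inter> {w \<in> words n. h w \<in> S}) = 2" .
qed auto

lemma is_line_append_left:
  assumes L: "is_line n L" and u: "u \<in> words m"
  shows "is_line (m + n) ((@) u ` L)"
proof -
  obtain i where i: "i < n" "\<And>x y j. x \<in> L \<Longrightarrow> y \<in> L \<Longrightarrow> j < n \<Longrightarrow> j \<noteq> i \<Longrightarrow> x ! j = y ! j"
    and sub: "L \<subseteq> words n" and card: "card L = 4"
    using L unfolding is_line_def by blast
  have len: "length u = m"
    using u by (simp add: words_def)
  show ?thesis
    unfolding is_line_def
  proof (intro conjI exI[of _ "m + i"])
    show "(@) u ` L \<subseteq> words (m + n)"
      using sub u by (auto intro: append_in_words)
    show "card ((@) u ` L) = 4"
      using card by (subst card_image) (auto simp: inj_on_def)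
    show "\<forall>x\<in>(@) u ` L. \<forall>y\<in>(@) u ` L. \<forall>j<m + n. j \<noteq> m + i \<longrightarrow> x ! j = y ! j"
    proof (clarsimp simp: nth_append len)
      fix x y j assume *: "x \<in> L" "y \<in> L" "j < m + n" "j \<noteq> m + i" "\<not> j < m"
      then show "x ! (j - m) = y ! (j - m)"
        by (intro i) auto
    qed
  qed (use i(1) in auto)
qed

lemma is_line_append_right:
  assumes L: "is_line m L" and v: "v \<in> words n"
  shows "is_line (m + n) ((\<lambda>u. u @ v) ` L)"
proof -
  obtain i where i: "i < m" "\<And>x y j. x \<in> L \<Longrightarrow> y \<in> L \<Longrightarrow> j < m \<Longrightarrow> j \<noteq> i \<Longrightarrow> x ! j = y ! j"
    and sub: "L \<subseteq> words m" and card: "card L = 4"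
    using L unfolding is_line_def by blast
  have len: "x \<in> L \<Longrightarrow> length x = m" for x
    using sub by (auto simp: words_def)
  show ?thesis
    unfolding is_line_def
  proof (intro conjI exI[of _ i])
    show "(\<lambda>u. u @ v) ` L \<subseteq> words (m + n)"
      using sub v by (auto intro: append_in_words)
    show "card ((\<lambda>u. u @ v) ` L) = 4"
      using card by (subst card_image) (auto simp: inj_on_def)
    show "\<forall>x\<in>(\<lambda>u. u @ v) ` L. \<forall>y\<in>(\<lambda>u. u @ v) ` L. \<forall>j<m + n. j \<noteq> i \<longrightarrow> x ! j = y ! j"
    proof (clarsimp simp: nth_append len)
      fix x y j assume "x \<in> L" "y \<in> L" "j < m" "j \<noteq> i"
      then show "x ! j = y ! j"
        by (rule i(2))
    qed
  qed (use i(1) in auto)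
qed

lemma double_MDS_code_left_section:
  assumes "double_MDS_code (m + n) S" and "u \<in> words m"
  shows "double_MDS_code n {v \<in> words n. u @ v \<in> S}"
  by (rule double_MDS_code_sectionI[OF assms(1) _ is_line_append_left[OF _ assms(2)]])
     (auto simp: inj_on_def)

lemma double_MDS_code_right_section:
  assumes "double_MDS_code (m + n) S" and "v \<in> words n"
  shows "double_MDS_code m {u \<in> words m. u @ v \<in> S}"
  by (rule double_MDS_code_sectionI[OF assms(1) _ is_line_append_right[OF _ assms(2)]])
     (auto simp: inj_on_def)


section \<open>Testing sets\<close>

definition testing_set :: "nat \<Rightarrow> nat list set \<Rightarrow> bool" where
  "testing_set n T \<longleftrightarrow> T \<subseteq> words n \<and>
     (\<forall>S S'. double_MDS_code n S \<longrightarrow> double_MDS_code n S' \<longrightarrow>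
        (\<forall>w\<in>T. w \<in> S \<longleftrightarrow> w \<in> S') \<longrightarrow> S = S')"

lemma testing_setD:
  assumes "testing_set n T" "double_MDS_code n S" "double_MDS_code n S'"
    "\<And>w. w \<in> T \<Longrightarrow> w \<in> S \<longleftrightarrow> w \<in> S'"
  shows "S = S'"
  using assms by (simp add: testing_set_def)

lemma testing_set_finite: "testing_set n T \<Longrightarrow> finite T"
  unfolding testing_set_def by (elim conjE) (rule finite_subset[OF _ finite_words])

lemma num_double_MDS_codes_le_testing_set:
  assumes T: "testing_set n T"
  shows "num_double_MDS_codes n \<le> 2 ^ card T"
proof -
  have fin: "finite T"
    by (rule testing_set_finite[OF T])
  have "inj_on (\<lambda>S. S \<inter> T) {S. double_MDS_code n S}"
  proof (rule inj_onI)
    fix S S' assume "S \<in> {S. double_MDS_code n S}" "S' \<in> {S. double_MDS_code n S}" "S \<inter> T = S' \<inter> T"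
    then show "S = S'"
      by (intro testing_setD[OF T, of S S']) blast+
  qed
  then have "card {S. double_MDS_code n S} \<le> card (Pow T)"
    using fin by (intro card_inj_on_le) auto
  then show ?thesis
    using fin by (simp add: num_double_MDS_codes_def card_Pow)
qed

lemma testing_set_append:
  assumes T: "testing_set m T" and U: "testing_set n U"
  shows "testing_set (m + n) ((\<lambda>(u, v). u @ v) ` (T \<times> U))"
  unfolding testing_set_def
proof (intro conjI allI impI)
  have sub: "T \<subseteq> words m" "U \<subseteq> words n"
    using T U by (auto simp: testing_set_def)
  then show "(\<lambda>(u, v). u @ v) ` (T \<times> U) \<subseteq> words (m + n)"
    by (auto intro: append_in_words)
  fix S S'
  assume S: "double_MDS_code (m + n) S" and S': "double_MDS_code (m + n) S'"
    and eq: "\<forall>w\<in>(\<lambda>(u, v). u @ v) ` (T \<times> U). w \<in> S \<longleftrightarrow> w \<in> S'"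
  \<comment> \<open>With a prefix from \<open>T\<close> fixed, agreement on \<open>U\<close> spreads
    to every suffix.\<close>
  have left: "{v \<in> words n. t @ v \<in> S} = {v \<in> words n. t @ v \<in> S'}" if "t \<in> T" for t
    using that sub eq S S'
    by (intro testing_setD[OF U] double_MDS_code_left_section) auto
  \<comment> \<open>Now any suffix can be fixed: by \<open>left\<close> the sections agree on
    \<open>T\<close>, hence at every prefix.\<close>
  have right: "{u \<in> words m. u @ v \<in> S} = {u \<in> words m. u @ v \<in> S'}" if "v \<in> words n" for v
    using that left S S'
    by (intro testing_setD[OF T] double_MDS_code_right_section) blast+
  show "S = S'"
  proof (rule double_MDS_code_eqI[OF S S'])
    fix w assume w: "w \<in> words (m + n)"
    have "take m w \<in> words m" "drop m w \<in> words n"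
      using w by (auto simp: words_def dest: in_set_takeD in_set_dropD)
    with right[of "drop m w"] have "take m w @ drop m w \<in> S \<longleftrightarrow> take m w @ drop m w \<in> S'"
      by blast
    then show "w \<in> S \<longleftrightarrow> w \<in> S'"
      by simp
  qed
qed

text \<open>There are no lines in dimension 0, so both subsets of \<open>words 0\<close> are codes,
  and the empty word separates them.\<close>

lemma testing_set_0: "testing_set 0 {[]}"
  by (auto simp: testing_set_def double_MDS_code_def words_def)

lemma testing_set_1: "testing_set 1 {[0], [1], [2]}"
  unfolding testing_set_def
proof (intro conjI allI impI)
  show "{[0], [1], [2]} \<subseteq> words 1"
    by (auto simp: words_def alphabet_def)
  fix S S'
  assume S: "double_MDS_code 1 S" and S': "double_MDS_code 1 S'"
    and eq: "\<forall>w\<in>{[0], [1], [2]}. w \<in> S \<longleftrightarrow> w \<in> S'"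
  \<comment> \<open>The whole space is a single line, whose sum 2 determines the fourth value from
    the other three.\<close>
  have "[3] \<in> S \<longleftrightarrow> [3] \<in> S'"
    using double_MDS_code_line_sum[OF S, of "[]" "[]"] double_MDS_code_line_sum[OF S', of "[]" "[]"] eq
    by (simp add: alphabet_def of_bool_def split: if_splits)
  moreover have "words 1 = {[0], [1], [2], [3]}"
    by (auto simp: words_def alphabet_def length_Suc_conv)
  ultimately show "S = S'"
    using eq by (intro double_MDS_code_eqI[OF S S']) auto
qed

section \<open>A testing set of 25 words in dimension three\<close>

definition testing_25 :: "(nat \<times> nat \<times> nat) set" where
  "testing_25 =
     {(0,0,0), (0,0,1), (0,1,0), (0,1,1), (0,1,3), (0,2,1),
      (1,1,0), (1,1,1), (1,2,0), (1,2,1), (1,2,2), (1,3,1), (1,3,2),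
      (2,0,0), (2,0,2), (2,1,1), (2,2,2), (2,2,3), (2,3,0), (2,3,3),
      (3,0,3), (3,2,0), (3,2,3), (3,3,0), (3,3,2)}"

text \<open>Elimination in stages: each value listed in \<open>k1\<close> to \<open>k7\<close> is
  the last unknown on a line whose other three values come from earlier stages. Together with
  \<open>k0\<close> they cover all 64 cells.\<close>

lemma zero_line_sums_testing_25:
  fixes g :: "nat \<Rightarrow> nat \<Rightarrow> nat \<Rightarrow> int"
  assumes bound: "\<And>i j k. \<bar>g i j k\<bar> \<le> 1"
    and s1: "\<And>j k. j \<in> alphabet \<Longrightarrow> k \<in> alphabet \<Longrightarrow> (\<Sum>x\<in>alphabet. g x j k) = 0"
    and s2: "\<And>i k. i \<in> alphabet \<Longrightarrow> k \<in> alphabet \<Longrightarrow> (\<Sum>x\<in>alphabet. g i x k) = 0"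
    and s3: "\<And>i j. i \<in> alphabet \<Longrightarrow> j \<in> alphabet \<Longrightarrow> (\<Sum>x\<in>alphabet. g i j x) = 0"
    and zero: "\<And>i j k. (i, j, k) \<in> testing_25 \<Longrightarrow> g i j k = 0"
    and ijk: "i \<in> alphabet" "j \<in> alphabet" "k \<in> alphabet"
  shows "g i j k = 0"
proof -
  \<comment> \<open>Keeps the letter \<open>1\<close> from becoming \<open>Suc 0\<close>, so that
    the collected equations match as rewrite rules.\<close>
  note One_nat_def [simp del]
  define a where "a = g 0 3 2"
  define b where "b = g 0 2 0"
  have "\<forall>(i, j, k)\<in>testing_25. g i j k = 0"
    using zero by auto
  note k0 = this[unfolded testing_25_def, simplified] a_def[symmetric] b_def[symmetric]
  have k1: "g 3 1 1 = 0" "g 2 2 0 = - b" "g 2 3 2 = - a" "g 0 3 0 = - b" "g 0 3 1 = 0"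
      "g 1 0 1 = 0" "g 0 1 2 = 0" "g 1 2 3 = 0"
    using s1[of 1 1] s1[of 2 0] s1[of 3 2] s2[of 0 0] s2[of 0 1] s2[of 1 1] s3[of 0 1] s3[of 1 2]
    by (simp_all add: alphabet_def k0)
  have k2: "g 0 2 3 = 0" "g 1 3 0 = b" "g 2 1 0 = b" "g 2 1 2 = a" "g 0 3 3 = - a + b"
      "g 2 2 1 = b" "g 2 3 1 = a"
    using s1[of 2 3] s1[of 3 0] s2[of 2 0] s2[of 2 2] s3[of 0 3] s3[of 2 2] s3[of 2 3]
    by (simp_all add: alphabet_def k0 k1)
  have k3: "g 3 1 0 = - b" "g 3 2 1 = - b" "g 3 3 1 = - a" "g 0 0 3 = a - b" "g 1 0 0 = - b"
      "g 2 0 1 = - a - b" "g 0 2 2 = - b" "g 1 3 3 = - b" "g 2 1 3 = - a - b"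
    using s1[of 1 0] s1[of 2 1] s1[of 3 1] s2[of 0 3] s2[of 1 0] s2[of 2 1] s3[of 0 2] s3[of 1 3] s3[of 2 1]
    by (simp_all add: alphabet_def k0 k1 k2)
  have k4: "g 3 0 0 = b" "g 3 0 1 = a + b" "g 3 2 2 = b" "g 3 3 3 = a" "g 0 0 2 = - a + b"
      "g 2 0 3 = a + b"
    using s1[of 0 0] s1[of 0 1] s1[of 2 2] s1[of 3 3] s2[of 0 2] s2[of 2 3]
    by (simp_all add: alphabet_def k0 k1 k2 k3)
  have k5: "g 1 0 3 = - 2 * a" "g 3 1 3 = - a" "g 3 0 2 = - a - 2 * b"
    using s1[of 0 3] s2[of 3 3] s3[of 3 0] by (simp_all add: alphabet_def k0 k1 k2 k3 k4)
  have k6: "g 1 0 2 = 2 * a + b" "g 1 1 3 = 2 * a + b" "g 3 1 2 = a + b"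
    using s1[of 0 2] s1[of 1 3] s2[of 3 2] by (simp_all add: alphabet_def k0 k1 k2 k3 k4 k5)
  have k7: "g 1 1 2 = - 2 * a - b"
    using s1[of 1 2] by (simp_all add: alphabet_def k0 k1 k2 k3 k4 k5 k6)
  \<comment> \<open>Integrality enters here: \<open>2 * a\<close> has modulus at most 1, so the
    integer \<open>a\<close> vanishes; the same argument then applies to
    \<open>2 * b\<close>.\<close>
  have "a = 0"
    using bound[of 1 0 3] k5 by linarith
  moreover have "b = 0"
    using bound[of 3 0 2] k5 \<open>a = 0\<close> by linarith
  ultimately show ?thesis
    using ijk by (auto simp: alphabet_def k0 k1 k2 k3 k4 k5 k6 k7)
qed

lemma testing_set_3: "testing_set 3 ((\<lambda>(i, j, k). [i, j, k]) ` testing_25)"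
  unfolding testing_set_def
proof (intro conjI allI impI)
  show "(\<lambda>(i, j, k). [i, j, k]) ` testing_25 \<subseteq> words 3"
    by (auto simp: testing_25_def words_def alphabet_def)
  fix S S'
  assume S: "double_MDS_code 3 S" and S': "double_MDS_code 3 S'"
    and eq: "\<forall>w\<in>(\<lambda>(i, j, k). [i, j, k]) ` testing_25. w \<in> S \<longleftrightarrow> w \<in> S'"
  define g :: "nat \<Rightarrow> nat \<Rightarrow> nat \<Rightarrow> int" where
    "g i j k = of_bool ([i, j, k] \<in> S) - of_bool ([i, j, k] \<in> S')" for i j k
  show "S = S'"
  proof (rule double_MDS_code_eqI[OF S S'])
    fix w assume "w \<in> words 3"
    then obtain i j k where w: "w = [i, j, k]" and ijk: "i \<in> alphabet" "j \<in> alphabet" "k \<in> alphabet"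
      by (auto simp: words_def numeral_3_eq_3 length_Suc_conv)
    have "g i j k = 0"
    proof (rule zero_line_sums_testing_25[OF _ _ _ _ _ ijk])
      show "\<bar>g i j k\<bar> \<le> 1" for i j k
        by (simp add: g_def)
      show "(\<Sum>x\<in>alphabet. g x j k) = 0" if "j \<in> alphabet" "k \<in> alphabet" for j k
        using double_MDS_code_line_sum[OF S, of "[]" "[j, k]"]
          double_MDS_code_line_sum[OF S', of "[]" "[j, k]"] that
        by (simp add: g_def sum_subtractf)
      show "(\<Sum>x\<in>alphabet. g i x k) = 0" if "i \<in> alphabet" "k \<in> alphabet" for i k
        using double_MDS_code_line_sum[OF S, of "[i]" "[k]"]
          double_MDS_code_line_sum[OF S', of "[i]" "[k]"] that
        by (simp add: g_def sum_subtractf)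
      show "(\<Sum>x\<in>alphabet. g i j x) = 0" if "i \<in> alphabet" "j \<in> alphabet" for i j
        using double_MDS_code_line_sum[OF S, of "[i, j]" "[]"]
          double_MDS_code_line_sum[OF S', of "[i, j]" "[]"] that
        by (simp add: g_def sum_subtractf)
      show "g i j k = 0" if "(i, j, k) \<in> testing_25" for i j k
        using eq that by (force simp: g_def)
    qed
    then show "w \<in> S \<longleftrightarrow> w \<in> S'"
      by (auto simp: g_def w of_bool_def split: if_splits)
  qed
qed

section \<open>Testing sets in every dimension\<close>

lemma testing_set_append_card_le:
  assumes "\<exists>T. testing_set m T \<and> card T \<le> a" and "\<exists>U. testing_set n U \<and> card U \<le> b"
  shows "\<exists>V. testing_set (m + n) V \<and> card V \<le> a * b"
proof -
  obtain T U where T: "testing_set m T" "card T \<le> a" and U: "testing_set n U" "card U \<le> b"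
    using assms by blast
  then have "finite T" "finite U"
    using testing_set_finite by auto
  then have "card ((\<lambda>(u, v). u @ v) ` (T \<times> U)) \<le> card T * card U"
    by (metis card_cartesian_product card_image_le finite_cartesian_product)
  also have "\<dots> \<le> a * b"
    using T U by (simp add: mult_mono)
  finally show ?thesis
    using testing_set_append[OF T(1) U(1)] by blast
qed

text \<open>Blocks of three coordinates are split off at a factor of 25 each; the at most two
  remaining coordinates cost a factor of 3 each.\<close>

lemma exists_testing_set: "\<exists>T. testing_set n T \<and> card T \<le> 25 ^ (n div 3) * 3 ^ (n mod 3)"
proof (induction n rule: less_induct)
  case (less n)
  have one: "\<exists>T. testing_set 1 T \<and> card T \<le> 3"
    using testing_set_1 by (intro exI[of _ "{[0], [1], [2]}"]) simp
  have "card ((\<lambda>(i, j, k). [i, j, k]) ` testing_25) \<le> card testing_25"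
    by (intro card_image_le) (simp add: testing_25_def)
  also have "\<dots> = 25"
    by (simp add: testing_25_def)
  finally have three: "\<exists>T. testing_set 3 T \<and> card T \<le> 25"
    using testing_set_3 by blast
  consider "n = 0" | "n = 1" | "n = 2" | "n \<ge> 3"
    by linarith
  then show ?case
  proof cases
    case 1
    then show ?thesis
      using testing_set_0 by (intro exI[of _ "{[]}"]) simp
  next
    case 2
    then show ?thesis
      using one by simp
  next
    case 3
    then show ?thesis
      using testing_set_append_card_le[OF one one] by (simp add: numeral_2_eq_2)
  next
    case 4
    then obtain m where m: "n = 3 + m"
      using le_Suc_ex by blast
    show ?thesis
      using testing_set_append_card_le[OF three less.IH[of m]] by (simp add: m mult.assoc)
  qed
qed

lemma num_double_MDS_codes_le:
  "real (num_double_MDS_codes n) \<le> 2 powr (25 ^ (n div 3) * 3 ^ (n mod 3))"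
proof -
  obtain T where T: "testing_set n T" "card T \<le> 25 ^ (n div 3) * 3 ^ (n mod 3)"
    using exists_testing_set by blast
  have "num_double_MDS_codes n \<le> 2 ^ card T"
    by (rule num_double_MDS_codes_le_testing_set[OF T(1)])
  also have "\<dots> \<le> 2 ^ (25 ^ (n div 3) * 3 ^ (n mod 3))"
    using T(2) by (intro power_increasing) auto
  finally have "real (num_double_MDS_codes n) \<le> real (2 ^ (25 ^ (n div 3) * 3 ^ (n mod 3)))"
    by (rule of_nat_mono)
  then show ?thesis
    by (simp add: powr_realpow[symmetric])
qed


section \<open>The numerical bounds\<close>

text \<open>Since 25 \<le> \<alpha>^3, the bound passes from \<open>m\<close> to
  \<open>3 + m\<close>, and the cases 3, 4, 5 suffice as a base. For \<open>n = 1\<close> and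
  \<open>n = 2\<close> the inequality fails, because \<alpha> < 3.\<close>

lemma testing_set_size_le_power:
  fixes \<alpha> :: real
  assumes \<alpha>: "\<alpha> ^ 5 = 225" "\<alpha> > 0" and "n \<ge> 3"
  shows "25 ^ (n div 3) * 3 ^ (n mod 3) \<le> \<alpha> ^ n"
  using \<open>n \<ge> 3\<close>
proof (induction n rule: less_induct)
  case (less n)
  \<comment> \<open>Only \<alpha>^5 is known, so fifth powers are compared: 25^5 \<le> 225^3 here
    and 75^5 \<le> 225^4 in \<open>a4\<close>.\<close>
  have a3: "25 \<le> \<alpha> ^ 3"
  proof (rule power_le_imp_le_base)
    have "(\<alpha> ^ 3) ^ Suc 4 = (\<alpha> ^ 5) ^ 3"
      by (simp flip: power_mult)
    then show "25 ^ Suc 4 \<le> (\<alpha> ^ 3) ^ Suc 4"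
      by (simp add: \<alpha>)
  qed (use \<alpha> in simp)
  have a4: "75 \<le> \<alpha> ^ 4"
  proof (rule power_le_imp_le_base)
    have "(\<alpha> ^ 4) ^ Suc 4 = (\<alpha> ^ 5) ^ 4"
      by (simp flip: power_mult)
    then show "75 ^ Suc 4 \<le> (\<alpha> ^ 4) ^ Suc 4"
      by (simp add: \<alpha>)
  qed (use \<alpha> in simp)
  \<comment> \<open>The base sizes are 25, 75 and 225; the last gives equality and so dictates
    \<alpha>.\<close>
  consider "n = 3" | "n = 4" | "n = 5" | "n \<ge> 6"
    using less.prems by linarith
  then show ?case
  proof cases
    case 4
    then obtain m where m: "n = 3 + m" "m \<ge> 3"
      using le_Suc_ex[of 3 n] by auto
    have "25 * (25 ^ (m div 3) * 3 ^ (m mod 3)) \<le> \<alpha> ^ 3 * \<alpha> ^ m"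
      using less.IH[of m] m a3 \<alpha> by (intro mult_mono) auto
    then show ?thesis
      by (simp add: m power_add mult.assoc)
  qed (use a3 a4 \<alpha> in simp_all)
qed

text \<open>The margin is thin, as 2.925^3 is about 25.025, but the ratio \<open>r\<close> is below
  1, so its powers eventually absorb any constant factor.\<close>

lemma eventually_testing_set_size_less_power:
  "\<forall>\<^sub>F n in sequentially. 25 ^ (n div 3) * 3 ^ (n mod 3) < (2.925::real) ^ n"
proof -
  define c :: real where "c = 2.925 ^ 3"
  define r where "r = 25 / c"
  have c: "c > 25"
    by (simp add: c_def power3_eq_cube)
  have "(\<lambda>k. r ^ k) \<longlonglongrightarrow> 0"
    by (rule LIMSEQ_realpow_zero) (use c in \<open>simp_all add: r_def\<close>)
  \<comment> \<open>The threshold offsets the factor \<open>3 ^ (n mod 3)\<close>, which is at most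
    9.\<close>
  then have "\<forall>\<^sub>F k in sequentially. r ^ k < 1 / 9"
    by (rule order_tendstoD) simp
  then obtain K where K: "\<And>k. k \<ge> K \<Longrightarrow> r ^ k < 1 / 9"
    by (auto simp: eventually_sequentially)
  have "25 ^ (n div 3) * 3 ^ (n mod 3) < (2.925::real) ^ n" if n: "n \<ge> 3 * K" for n
  proof -
    have "(3::real) ^ (n mod 3) \<le> 3 ^ 2"
      by (intro power_increasing) auto
    then have "25 ^ (n div 3) * 3 ^ (n mod 3) \<le> 9 * (25::real) ^ (n div 3)"
      by simp
    also have "r ^ (n div 3) < 1 / 9"
      using n by (intro K) linarith
    then have "9 * (25::real) ^ (n div 3) < c ^ (n div 3)"
      using c by (simp add: r_def power_divide field_simps)
    also have "\<dots> = 2.925 ^ (3 * (n div 3))"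
      by (simp only: power_mult c_def)
    also have "\<dots> \<le> (2.925::real) ^ n"
      by (intro power_increasing) auto
    finally show ?thesis .
  qed
  then show ?thesis
    unfolding eventually_sequentially by blast
qed

theorem theorem5:
  shows "(\<exists>\<alpha>::real. \<alpha> = 225 powr (1/5) \<and> \<alpha> < 2.955 \<and>
            (\<forall>n\<ge>3. real (num_double_MDS_codes n) \<le> 2 powr (\<alpha> ^ n)))
       \<and> (\<forall>\<^sub>F n in sequentially. real (num_double_MDS_codes n) < 2 powr ((2.925::real) ^ n))"
proof (intro conjI exI allI impI)
  define \<alpha> :: real where "\<alpha> = 225 powr (1/5)"
  have pos: "\<alpha> > 0"
    by (simp add: \<alpha>_def)
  have \<alpha>5: "\<alpha> ^ 5 = 225"
    by (simp add: \<alpha>_def powr_power)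
  \<comment> \<open>The right-hand side is about 225.3.\<close>
  have "\<alpha> ^ 5 < 2.955 ^ 5"
    unfolding \<alpha>5 by (simp add: eval_nat_numeral)
  then have "\<alpha> < 2.955"
    by (rule power_less_imp_less_base) simp
  then show "225 powr (1/5) < (2.955::real)"
    by (simp add: \<alpha>_def)
  fix n :: nat assume "n \<ge> 3"
  then have "25 ^ (n div 3) * 3 ^ (n mod 3) \<le> \<alpha> ^ n"
    by (rule testing_set_size_le_power[OF \<alpha>5 pos])
  then show "real (num_double_MDS_codes n) \<le> 2 powr ((225 powr (1/5)) ^ n)"
    unfolding \<alpha>_def by (intro order_trans[OF num_double_MDS_codes_le]) simp
next
  show "\<forall>\<^sub>F n in sequentially. real (num_double_MDS_codes n) < 2 powr ((2.925::real) ^ n)"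
    using eventually_testing_set_size_less_power
    by eventually_elim (rule le_less_trans[OF num_double_MDS_codes_le], simp)
qed (rule refl)

end
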